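(* Let $\delta=hD_{con}$ for some $h\in\mathbb{K}^*$. Then $\mathbb{T}_\delta\cong(\mathbb{K}^* )^{m-2}\times\mathbb{Z}_s$, where $s=\gcd(k_2,\dots,k_m)$.
   Context: $\mathbb{K}$ is an algebraically closed field of characteristic zero; $d,m,k_2,\dots,k_m$ are integers $\geqslant 2$. The Danielewski variety with constant coefficients $\mathbb{V}_{con}$ is the affine variety with coordinate ring $\mathbb{K}[\mathbb{V}_{con}]=\mathbb{K}[Y_1,\dots,Y_m,Z]/(Y_1Y_2^{k_2}\cdots Y_m^{k_m}-P(Z))$, where $P(Z)\in\mathbb{K}[Z]$ is monic of degree $d$; $y_1,\dots,y_m,z$ are the images of $Y_1,\dots,Y_m,Z$. The canonical locally nilpotent derivation $D_{con}$ is the $\mathbb{K}$-derivation with $D_{con}(y_1)=P'(z)$, $D_{con}(z)=y_2^{k_2}\cdots y_m^{k_m}$, $D_{con}(y_j)=0$ for $j\geqslant2$. $\mathbb{T}$ (the proper torus) is the group of automorphisms $\theta$ of $\mathbb{K}[\mathbb{V}_{con}]$ of the form $\theta(y_j)=\lambda_jy_j$ ($1\leqslant j\leqslant m$), $\theta(z)=z$, with $\lambda_j\in\mathbb{K}^*$ and $\lambda_1\lambda_2^{k_2}\cdots\lambda_m^{k_m}=1$. $\mathrm{Aut}(\delta)$ is the group of $\mathbb{K}$-algebra automorphisms of $\mathbb{K}[\mathbb{V}_{con}]$ commuting with $\delta$, and $\mathbb{T}_\delta=\mathbb{T}\cap\mathrm{Aut}(\delta)$. $\mathbb{Z}_s$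 is the cyclic group of order $s$. *)

theory Defs
  imports
    "HOL-Library.Poly_Mapping"
    "HOL-Computational_Algebra.Polynomial"
    "HOL-Algebra.QuotRing"
    "HOL-Algebra.Bij"
    "HOL-Algebra.Elementary_Groups"
    "HOL-Algebra.Product_Groups"
begin

section \<open>Polynomial rings\<close>

text \<open>Monomials are finitely supported exponent functions, and the ring structure on
  polynomials is the convolution product of \<^theory>\<open>HOL-Library.Poly_Mapping\<close>. The type
  provides all variables \<open>VarY 0, VarY 1, \<dots>, VarZ\<close>; the polynomial ring in finitely many of
  them is cut out by its carrier.\<close>

datatype dvar = VarY nat | VarZ

type_synonym 'k dpoly = "(dvar \<Rightarrow>\<^sub>0 nat) \<Rightarrow>\<^sub>0 'k"

definition dconst :: "'k::comm_ring_1 \<Rightarrow> 'k dpoly" where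
  "dconst c = Poly_Mapping.single 0 c"

definition dvariable :: "dvar \<Rightarrow> 'k::comm_ring_1 dpoly" where
  "dvariable v = Poly_Mapping.single (Poly_Mapping.single v 1) 1"

definition dpoly_ring :: "dvar set \<Rightarrow> ('k::comm_ring_1 dpoly) ring" where
  "dpoly_ring V =
    \<lparr>carrier = {p. \<forall>a\<in>Poly_Mapping.keys p. Poly_Mapping.keys a \<subseteq> V},
     mult = (*), one = 1, zero = 0, add = (+)\<rparr>"

definition eval_Z :: "'k::comm_ring_1 poly \<Rightarrow> 'k dpoly" where
  "eval_Z P = poly (map_poly dconst P) (dvariable VarZ)"


section \<open>The Danielewski variety with constant coefficients\<close>

text \<open>The exponents are given by a function \<open>k\<close>, of which only the values at \<open>2, \<dots>, m\<close>
  matter.\<close>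

definition danielewski_poly_ring :: "nat \<Rightarrow> ('k::comm_ring_1 dpoly) ring" where
  "danielewski_poly_ring m = dpoly_ring (insert VarZ (VarY ` {1..m}))"

definition danielewski_monom :: "nat \<Rightarrow> (nat \<Rightarrow> nat) \<Rightarrow> 'k::comm_ring_1 dpoly" where
  "danielewski_monom m k = (\<Prod>j\<in>{2..m}. dvariable (VarY j) ^ k j)"

definition danielewski_ideal ::
  "nat \<Rightarrow> (nat \<Rightarrow> nat) \<Rightarrow> 'k::comm_ring_1 poly \<Rightarrow> 'k dpoly set" where
  "danielewski_ideal m k P =
    PIdl\<^bsub>danielewski_poly_ring m\<^esub> (dvariable (VarY 1) * danielewski_monom m k - eval_Z P)"

definition danielewski_ring ::
  "nat \<Rightarrow> (nat \<Rightarrow> nat) \<Rightarrow> 'k::comm_ring_1 poly \<Rightarrow> ('k dpoly set) ring" where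
  "danielewski_ring m k P = danielewski_poly_ring m Quot danielewski_ideal m k P"

definition danielewski_class ::
  "nat \<Rightarrow> (nat \<Rightarrow> nat) \<Rightarrow> 'k::comm_ring_1 poly \<Rightarrow> 'k dpoly \<Rightarrow> 'k dpoly set" where
  "danielewski_class m k P p =
    danielewski_ideal m k P +>\<^bsub>danielewski_poly_ring m\<^esub> p"

definition danielewski_const ::
  "nat \<Rightarrow> (nat \<Rightarrow> nat) \<Rightarrow> 'k::comm_ring_1 poly \<Rightarrow> 'k \<Rightarrow> 'k dpoly set" where
  "danielewski_const m k P c = danielewski_class m k P (dconst c)"

definition danielewski_y ::
  "nat \<Rightarrow> (nat \<Rightarrow> nat) \<Rightarrow> 'k::comm_ring_1 poly \<Rightarrow> nat \<Rightarrow> 'k dpoly set" where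
  "danielewski_y m k P j = danielewski_class m k P (dvariable (VarY j))"

definition danielewski_z ::
  "nat \<Rightarrow> (nat \<Rightarrow> nat) \<Rightarrow> 'k::comm_ring_1 poly \<Rightarrow> 'k dpoly set" where
  "danielewski_z m k P = danielewski_class m k P (dvariable VarZ)"


section \<open>Derivations and automorphisms of algebras\<close>

text \<open>A \<open>\<bbbK>\<close>-algebra is a commutative ring \<open>A\<close> together with its structure map
  \<open>\<iota> :: 'k \<Rightarrow> 'a\<close>. Automorphisms are undefined outside the carrier, as the elements of
  \<^const>\<open>BijGroup\<close> are, so that they are determined by their action on \<open>A\<close>.\<close>

definition alg_derivation ::
  "('a, 'c) ring_scheme \<Rightarrow> ('k \<Rightarrow> 'a) \<Rightarrow> ('a \<Rightarrow> 'a) \<Rightarrow> bool" where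
  "alg_derivation A \<iota> D \<longleftrightarrow>
     D \<in> carrier A \<rightarrow> carrier A \<and>
     (\<forall>f\<in>carrier A. \<forall>g\<in>carrier A. D (f \<oplus>\<^bsub>A\<^esub> g) = D f \<oplus>\<^bsub>A\<^esub> D g) \<and>
     (\<forall>f\<in>carrier A. \<forall>g\<in>carrier A.
        D (f \<otimes>\<^bsub>A\<^esub> g) = (D f \<otimes>\<^bsub>A\<^esub> g) \<oplus>\<^bsub>A\<^esub> (f \<otimes>\<^bsub>A\<^esub> D g)) \<and>
     (\<forall>c. D (\<iota> c) = \<zero>\<^bsub>A\<^esub>)"

definition alg_auts ::
  "('a, 'c) ring_scheme \<Rightarrow> ('k \<Rightarrow> 'a) \<Rightarrow> ('a \<Rightarrow> 'a) set" where
  "alg_auts A \<iota> = {\<theta> \<in> Bij (carrier A). \<theta> \<in> ring_hom A A \<and> (\<forall>c. \<theta> (\<iota> c) = \<iota> c)}"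

definition alg_auts_commuting ::
  "('a, 'c) ring_scheme \<Rightarrow> ('k \<Rightarrow> 'a) \<Rightarrow> ('a \<Rightarrow> 'a) \<Rightarrow> ('a \<Rightarrow> 'a) set" where
  "alg_auts_commuting A \<iota> \<delta> =
    {\<theta> \<in> alg_auts A \<iota>. \<forall>f\<in>carrier A. \<theta> (\<delta> f) = \<delta> (\<theta> f)}"


section \<open>The canonical derivation and the proper torus\<close>

text \<open>The predicate determines \<open>D\<close> on the carrier, since the images of the variables and
  the constants generate the ring. Such a \<open>D\<close> exists: the derivation
  \<open>P'(Z) \<partial>/\<partial>Y\<^sub>1 + Y\<^sub>2^k\<^sub>2 \<cdots> Y\<^sub>m^k\<^sub>m \<partial>/\<partial>Z\<close> of the polynomial ring
  annihilates the defining equation, so it descends to the quotient.\<close>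

definition is_canonical_derivation ::
  "nat \<Rightarrow> (nat \<Rightarrow> nat) \<Rightarrow> 'k::field poly \<Rightarrow> ('k dpoly set \<Rightarrow> 'k dpoly set) \<Rightarrow> bool" where
  "is_canonical_derivation m k P D \<longleftrightarrow>
     alg_derivation (danielewski_ring m k P) (danielewski_const m k P) D \<and>
     D (danielewski_y m k P 1) = danielewski_class m k P (eval_Z (pderiv P)) \<and>
     D (danielewski_z m k P) = danielewski_class m k P (danielewski_monom m k) \<and>
     (\<forall>j\<in>{2..m}. D (danielewski_y m k P j) = \<zero>\<^bsub>danielewski_ring m k P\<^esub>)"

definition proper_torus ::
  "nat \<Rightarrow> (nat \<Rightarrow> nat) \<Rightarrow> 'k::field poly \<Rightarrow> ('k dpoly set \<Rightarrow> 'k dpoly set) set" where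
  "proper_torus m k P =
    {\<theta> \<in> alg_auts (danielewski_ring m k P) (danielewski_const m k P).
       \<exists>l. (\<forall>j\<in>{1..m}. l j \<noteq> 0) \<and> l 1 * (\<Prod>j\<in>{2..m}. l j ^ k j) = 1 \<and>
           (\<forall>j\<in>{1..m}. \<theta> (danielewski_y m k P j) =
              danielewski_const m k P (l j) \<otimes>\<^bsub>danielewski_ring m k P\<^esub> danielewski_y m k P j) \<and>
           \<theta> (danielewski_z m k P) = danielewski_z m k P}"

definition torus_isotropy ::
  "nat \<Rightarrow> (nat \<Rightarrow> nat) \<Rightarrow> 'k::field poly \<Rightarrow> ('k dpoly set \<Rightarrow> 'k dpoly set)
    \<Rightarrow> ('k dpoly set \<Rightarrow> 'k dpoly set) monoid" where
  "torus_isotropy m k P \<delta> =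
    (BijGroup (carrier (danielewski_ring m k P)))
      \<lparr>carrier := proper_torus m k P \<inter>
         alg_auts_commuting (danielewski_ring m k P) (danielewski_const m k P) \<delta>\<rparr>"

definition mult_group :: "'k::field monoid" where
  "mult_group = \<lparr>carrier = UNIV - {0}, mult = (*), one = 1\<rparr>"

end

theory Submission
  imports Defs
begin

text \<open>An element of the torus commutes with \<open>\<delta>\<close> iff it fixes \<open>\<delta>(z)\<close>, a nonzero multiple of
  \<open>y\<^sub>2^k\<^sub>2 \<cdots> y\<^sub>m^k\<^sub>m\<close>, so the isotropy group is the subgroup \<open>\<Prod> \<lambda>\<^sub>j^k\<^sub>j = 1\<close> of
  \<open>(\<bbbK>\<^sup>*)\<^sup>m\<^sup>-\<^sup>1\<close>. The substitution \<open>\<lambda>\<^sub>j \<mapsto> \<lambda>\<^sub>i \<lambda>\<^sub>j\<close> replaces the exponent \<open>k\<^sub>i\<close> by \<open>k\<^sub>i - k\<^sub>j\<close>;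
  running the Euclidean algorithm in this way leaves a single nonzero exponent, the gcd \<open>s\<close>,
  and the subgroup becomes the product of \<open>m - 2\<close> copies of \<open>\<bbbK>\<^sup>*\<close> with the group of \<open>s\<close>-th
  roots of unity.\<close>

section \<open>Roots of unity and kernels of characters\<close>

lemma group_mult_group [simp]: "group (mult_group :: 'k::field monoid)"
proof (rule groupI)
  fix x assume "x \<in> carrier (mult_group :: 'k monoid)"
  then show "\<exists>y\<in>carrier mult_group. y \<otimes>\<^bsub>mult_group\<^esub> x = \<one>\<^bsub>mult_group\<^esub>"
    by (intro bexI[of _ "inverse x"]) (auto simp: mult_group_def)
qed (auto simp: mult_group_def)

section \<open>Primitive roots of unity\<close>

text \<open>Induction on \<open>n\<close>, splitting off a prime: \<open>n = p * n'\<close>. If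
  \<open>p\<close> divides \<open>n'\<close>, a \<open>p\<close>-th root of an element of order
  \<open>n'\<close> has order \<open>n\<close>. Otherwise an element of order \<open>n'\<close> is
  multiplied by one of order \<open>p\<close>, and coprime orders multiply.\<close>

lemma primitive_root_of_unity_exists:
  assumes "n > 0"
  obtains w :: "'k::{alg_closed_field, field_char_0}"
  where "w ^ n = 1" "\<And>i. w ^ i = 1 \<Longrightarrow> n dvd i"
proof -
  have "\<exists>w::'k. w ^ n = 1 \<and> (\<forall>i. w ^ i = 1 \<longrightarrow> n dvd i)"
    using assms
  proof (induction n rule: less_induct)
    case (less n)
    show ?case
    proof (cases "n = 1")
      case True
      then show ?thesis by (intro exI[of _ 1]) simp
    next
      case False
      with less.prems obtain p where p: "prime p" "p dvd n"
        using prime_factor_nat by blast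
      then obtain n' where n: "n = p * n'" by (elim dvdE)
      have "n' > 0" "n' < n"
        using less.prems n prime_gt_1_nat[OF p(1)] by auto
      with less.IH obtain w :: 'k where w: "w ^ n' = 1" "\<And>i. w ^ i = 1 \<Longrightarrow> n' dvd i"
        by blast
      show ?thesis
      proof (cases "p dvd n'")
        case True
        obtain u where u: "u ^ p = w"
          using nth_root_exists prime_gt_0_nat[OF p(1)] by metis
        \<comment> \<open>Divisibility is used twice: \<open>u ^ i = 1\<close> gives
          \<open>w ^ i = 1\<close>, so \<open>p\<close> divides \<open>n'\<close> and hence
          \<open>i\<close>; writing \<open>i = p * j\<close> turns \<open>u ^ i\<close> into
          \<open>w ^ j\<close>, which gives \<open>n'\<close> dividing \<open>j\<close>.\<close>
        have "n dvd i" if "u ^ i = 1" for i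
        proof -
          have "w ^ i = 1" using that by (metis u power_mult mult.commute power_one)
          then have "p dvd i" using w(2) True dvd_trans by blast
          then obtain j where j: "i = p * j" by (elim dvdE)
          then have "w ^ j = 1" using that u by (simp add: power_mult)
          then show ?thesis using w(2) j n by auto
        qed
        then show ?thesis using u w(1) n by (intro exI[of _ u]) (simp add: power_mult)
      next
        case False
        \<comment> \<open>The \<open>p\<close>-th cyclotomic polynomial. Since
          \<open>q(1) = p\<close> is nonzero in characteristic zero, a root \<open>e\<close> of
          \<open>q\<close> is a \<open>p\<close>-th root of unity other than 1.\<close>
        define q where "q = (\<Sum>i<p. monom (1::'k) i)"
        have cq: "coeff q i = (if i < p then 1 else 0)" for i
          by (simp add: q_def coeff_sum)
        have pq: "poly q x = (\<Sum>i<p. x ^ i)" for x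
          by (simp add: q_def poly_sum poly_monom)
        have "Polynomial.degree q > 0"
          using le_degree[of q 1] cq[of 1] prime_gt_1_nat[OF p(1)] by simp
        then obtain e where e: "poly q e = 0"
          using alg_closed_imp_poly_has_root by blast
        have e1: "e \<noteq> 1"
          using e pq[of 1] prime_gt_0_nat[OF p(1)] by auto
        have ep: "e ^ p = 1"
          using e pq[of e] geometric_sum[OF e1, of p] e1 by simp
        have ed: "p dvd i" if "e ^ i = 1" for i
        proof (rule ccontr)
          assume "\<not> p dvd i"
          then have c: "coprime i p"
            using p(1) by (metis coprime_commute prime_imp_coprime)
          have "i \<noteq> 0" using \<open>\<not> p dvd i\<close> by (metis dvd_0_right)
          then obtain a b where "i * a = p * b + gcd i p"
            using bezout_nat by blast
          then have "i * a = p * b + 1" using c by simp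
          then have "e ^ (i * a) = e ^ (p * b) * e" by simp
          then show False using that ep e1 by (simp add: power_mult)
        qed
        have "n dvd i" if i: "(e * w) ^ i = 1" for i
        proof -
          \<comment> \<open>The \<open>p\<close>-th power removes \<open>e\<close>, which yields
            \<open>n'\<close> dividing \<open>i\<close> by coprimality; then
            \<open>w ^ i = 1\<close> and only \<open>e ^ i = 1\<close> remains.\<close>
          have "((e * w) ^ i) ^ p = (e ^ p) ^ i * w ^ (i * p)"
            by (simp add: power_mult_distrib power_mult[symmetric] mult.commute)
          then have "w ^ (i * p) = 1" using i ep by simp
          then have "n' dvd i * p" by (rule w(2))
          moreover have "coprime n' p"
            using False p(1) by (metis coprime_commute prime_imp_coprime)
          ultimately have d: "n' dvd i" by (metis coprime_dvd_mult_left_iff)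
          then have "w ^ i = 1" using w(1) by (auto simp: power_mult elim!: dvdE)
          then have "p dvd i" using i ed by (simp add: power_mult_distrib)
          then show ?thesis unfolding n using d \<open>coprime n' p\<close>
            by (metis coprime_commute divides_mult)
        qed
        moreover have "(e * w) ^ n = 1"
          unfolding n power_mult_distrib power_mult ep
          by (metis mult_1 power_mult mult.commute power_one w(1))
        ultimately show ?thesis by blast
      qed
    qed
  qed
  then show ?thesis using that by blast
qed

text \<open>The first \<open>n\<close> powers of a primitive root are distinct, and
  \<open>X^n - 1\<close> has at most \<open>n\<close> roots, so these powers are all of them. The
  exponents are integers to match the carrier of \<open>integer_mod_group n\<close>.\<close>

lemma bij_betw_roots_of_unity:
  assumes "n > 0"
  obtains w :: "'k::{alg_closed_field, field_char_0}"
  where "w ^ n = 1" "bij_betw (\<lambda>a. w ^ nat a) {0..<int n} {x. x ^ n = 1}"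
proof -
  obtain w :: 'k where w: "w ^ n = 1" "\<And>i. w ^ i = 1 \<Longrightarrow> n dvd i"
    using primitive_root_of_unity_exists[OF assms] by blast
  have w0: "w \<noteq> 0" using w(1) assms by (auto simp: zero_power)
  define p where "p = monom (1::'k) n - 1"
  have p0: "p \<noteq> 0"
  proof
    assume "p = 0"
    then have "coeff p n = 0" by simp
    then show False using assms by (simp add: p_def)
  qed
  have roots: "{x. poly p x = 0} = {x. x ^ n = 1}"
    by (simp add: p_def poly_monom)
  have degp: "Polynomial.degree p \<le> n"
    unfolding p_def by (intro degree_diff_le) (auto simp: degree_monom_le)
  have fin: "finite {x::'k. x ^ n = 1}" using poly_roots_finite[OF p0] roots by simp
  have card: "card {x::'k. x ^ n = 1} \<le> n"
    using card_poly_roots_bound[OF p0] roots degp by simp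
  have le: "a = b" if "w ^ a = w ^ b" "b < n" "a \<le> b" for a b :: nat
  proof -
    have "w ^ b = w ^ a * w ^ (b - a)" using that by (metis le_add_diff_inverse power_add)
    then have "w ^ (b - a) = 1" using that(1) w0 by simp
    then have "n dvd b - a" by (rule w(2))
    then show ?thesis using that by (auto dest: dvd_imp_le)
  qed
  have inj: "inj_on (\<lambda>a. w ^ nat a) {0..<int n}"
  proof (rule inj_onI)
    fix a b assume ab: "a \<in> {0..<int n}" "b \<in> {0..<int n}" "w ^ nat a = w ^ nat b"
    then have "nat a = nat b"
      using le[of "nat a" "nat b"] le[of "nat b" "nat a"]
      by (metis atLeastLessThan_iff linorder_le_cases nat_less_iff)
    then show "a = b" using ab by auto
  qed
  have sub: "(\<lambda>a. w ^ nat a) ` {0..<int n} \<subseteq> {x. x ^ n = 1}"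
    using w(1) by (auto simp: power_mult[symmetric] mult.commute[of _ n]) (simp add: power_mult)
  have "(\<lambda>a. w ^ nat a) ` {0..<int n} = {x. x ^ n = 1}"
    by (rule card_seteq[OF fin sub]) (use card card_image[OF inj] in simp)
  with inj w(1) show ?thesis using that by (auto simp: bij_betw_def)
qed

section \<open>Kernels of characters on tori and the Euclidean algorithm on their exponents\<close>

text \<open>The kernel of the monomial character with exponents \<open>k\<close> on the torus with
  coordinates indexed by \<open>A\<close>.\<close>

definition torus_kernel :: "'i set \<Rightarrow> ('i \<Rightarrow> nat) \<Rightarrow> ('i \<Rightarrow> 'k::field) monoid" where
  "torus_kernel A k = product_group A (\<lambda>_. mult_group)
     \<lparr>carrier := {x \<in> A \<rightarrow>\<^sub>E UNIV - {0}. (\<Prod>j\<in>A. x j ^ k j) = 1}\<rparr>"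

lemma carrier_torus_kernel [simp]:
  "carrier (torus_kernel A k) = {x \<in> A \<rightarrow>\<^sub>E UNIV - {0}. (\<Prod>j\<in>A. x j ^ k j) = 1}"
  by (simp add: torus_kernel_def)

lemma mult_torus_kernel [simp]:
  "x \<otimes>\<^bsub>torus_kernel A k\<^esub> y = (\<lambda>j\<in>A. x j * y j)"
  by (simp add: torus_kernel_def mult_group_def)

lemma one_torus_kernel [simp]: "\<one>\<^bsub>torus_kernel A k\<^esub> = (\<lambda>j\<in>A. 1)"
  by (simp add: torus_kernel_def mult_group_def)

lemma group_torus_kernel [simp]: "group (torus_kernel A k :: ('i \<Rightarrow> 'k::field) monoid)"
proof (rule groupI)
  fix x assume x: "x \<in> carrier (torus_kernel A k :: ('i \<Rightarrow> 'k) monoid)"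
  then show "\<exists>y\<in>carrier (torus_kernel A k). y \<otimes>\<^bsub>torus_kernel A k\<^esub> x = \<one>\<^bsub>torus_kernel A k\<^esub>"
    by (intro bexI[of _ "\<lambda>j\<in>A. inverse (x j)"])
      (auto simp: PiE_iff power_inverse prod_inversef[unfolded comp_def] fun_eq_iff cong: prod.cong)
next
  fix x y assume "x \<in> carrier (torus_kernel A k :: ('i \<Rightarrow> 'k) monoid)"
    "y \<in> carrier (torus_kernel A k :: ('i \<Rightarrow> 'k) monoid)"
  then show "x \<otimes>\<^bsub>torus_kernel A k\<^esub> y \<in> carrier (torus_kernel A k)"
    by (auto simp: PiE_iff power_mult_distrib prod.distrib cong: prod.cong)
next
  fix x assume "x \<in> carrier (torus_kernel A k :: ('i \<Rightarrow> 'k) monoid)"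
  then show "\<one>\<^bsub>torus_kernel A k\<^esub> \<otimes>\<^bsub>torus_kernel A k\<^esub> x = x"
    by (auto simp: PiE_iff extensional_def fun_eq_iff)
qed (auto simp: fun_eq_iff mult.assoc)

text \<open>The coordinate change \<open>x_j \<mapsto> x_i * x_j\<close> is invertible on the torus,
  and \<open>x_i^(k_i) * x_j^(k_j) = x_i^(k_i - k_j) * (x_i * x_j)^(k_j)\<close>. The bound
  \<open>k j \<le> k i\<close> makes the truncated subtraction exact.\<close>

lemma torus_kernel_shear:
  fixes k :: "'i \<Rightarrow> nat"
  assumes "finite A" "i \<in> A" "j \<in> A" "i \<noteq> j" "k j \<le> k i"
  shows "(torus_kernel A k :: ('i \<Rightarrow> 'k::field) monoid) \<cong>
    (torus_kernel A (k(i := k i - k j)) :: ('i \<Rightarrow> 'k) monoid)"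
proof -
  let ?k' = "k(i := k i - k j)"
  let ?f = "\<lambda>x::'i \<Rightarrow> 'k. x(j := x i * x j)"
  have A: "A = insert i (insert j (A - {i, j}))" using assms by auto
  have split: "(\<Prod>l\<in>A. g l) = g i * (g j * (\<Prod>l\<in>A - {i, j}. g l))" for g :: "'i \<Rightarrow> 'k"
    using assms by (subst A) (subst prod.insert, auto)+
  have rest: "(\<Prod>l\<in>A - {i, j}. (x(j := u)) l ^ ?k' l) = (\<Prod>l\<in>A - {i, j}. x l ^ k l)"
    for x :: "'i \<Rightarrow> 'k" and u by (rule prod.cong) auto
  \<comment> \<open>Stated for every \<open>x\<close>, so that it serves both directions: for the
    image under \<open>?f\<close>, and for the candidate preimage below.\<close>
  have eq: "(\<Prod>l\<in>A. ?f x l ^ ?k' l) = (\<Prod>l\<in>A. x l ^ k l)" for x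
  proof -
    have "x i ^ k i = x i ^ (k i - k j) * x i ^ k j"
      using assms by (simp flip: power_add)
    then show ?thesis
      unfolding split[of "\<lambda>l. ?f x l ^ ?k' l"] split[of "\<lambda>l. x l ^ k l"] rest
      using assms by (simp add: power_mult_distrib mult_ac)
  qed
  have f: "?f \<in> hom (torus_kernel A k) (torus_kernel A ?k')"
  proof (rule homI)
    show "?f x \<in> carrier (torus_kernel A ?k')"
      if "x \<in> carrier (torus_kernel A k)" for x
      using that assms eq[of x] by (simp add: PiE_iff extensional_def)
  qed (use assms in \<open>auto simp: fun_eq_iff mult_ac\<close>)
  have "bij_betw ?f (carrier (torus_kernel A k)) (carrier (torus_kernel A ?k'))"
  proof (rule bij_betw_byWitness[where f' = "\<lambda>x. x(j := x j / x i)"])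
    show "?f ` carrier (torus_kernel A k) \<subseteq> carrier (torus_kernel A ?k')"
      by (rule hom_carrier[OF f])
    show "(\<lambda>x. x(j := x j / x i)) ` carrier (torus_kernel A ?k') \<subseteq>
        carrier (torus_kernel A k :: ('i \<Rightarrow> 'k) monoid)"
    proof (rule image_subsetI)
      fix x assume x: "x \<in> carrier (torus_kernel A ?k' :: ('i \<Rightarrow> 'k) monoid)"
      let ?y = "x(j := x j / x i)"
      have "?f ?y = x" using x assms by (auto simp: PiE_iff fun_eq_iff)
      then have "(\<Prod>l\<in>A. ?y l ^ k l) = 1" using eq[of ?y] x by simp
      then show "?y \<in> carrier (torus_kernel A k)"
        using x assms by (auto simp: PiE_iff extensional_def)
    qed
  qed (use assms in \<open>auto simp: PiE_iff fun_eq_iff\<close>)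
  with f show ?thesis by (intro is_isoI isoI)
qed

text \<open>The relation reduces to \<open>x_i^(k_i) = 1\<close>: the coordinate at \<open>i\<close>
  runs through a cyclic group of roots of unity, and the other \<open>card A - 1\<close> coordinates
  are free.\<close>

lemma torus_kernel_single:
  fixes k :: "'i \<Rightarrow> nat"
  assumes "finite A" "i \<in> A" "k i > 0" "\<And>j. j \<in> A \<Longrightarrow> j \<noteq> i \<Longrightarrow> k j = 0"
  shows "(torus_kernel A k :: ('i \<Rightarrow> 'k::{alg_closed_field, field_char_0}) monoid) \<cong>
    product_group {..<card A - 1} (\<lambda>_. mult_group :: 'k monoid) \<times>\<times> integer_mod_group (k i)"
proof -
  let ?P = "product_group {..<card A - 1} (\<lambda>_. mult_group :: 'k monoid)"
  let ?G = "?P \<times>\<times> integer_mod_group (k i)"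
  obtain w :: 'k where w: "w ^ k i = 1"
    and bij: "bij_betw (\<lambda>a. w ^ nat a) {0..<int (k i)} {x. x ^ k i = 1}"
    using bij_betw_roots_of_unity[OF assms(3)] by blast
  have w0: "w \<noteq> 0" using w assms(3) by (auto simp: zero_power)
  \<comment> \<open>The discrete logarithm to base \<open>w\<close>.\<close>
  define lg where "lg = inv_into {0..<int (k i)} (\<lambda>a. w ^ nat a)"
  have lg1: "lg (w ^ nat a) = a" if "a \<in> {0..<int (k i)}" for a
    unfolding lg_def using bij_betw_inv_into_left[OF bij that] .
  have lg2: "w ^ nat (lg x) = x" if "x ^ k i = 1" for x
    unfolding lg_def using bij_betw_inv_into_right[OF bij] that by simp
  have lg3: "lg x \<in> {0..<int (k i)}" if "x ^ k i = 1" for x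
    unfolding lg_def using bij_betw_inv_into[OF bij] that by (auto simp: bij_betw_def)
  have "card (A - {i}) = card {..<card A - 1}" using assms by simp
  \<comment> \<open>A numbering \<open>e\<close> of the free coordinates, with inverse
    \<open>g\<close> below, matches them with the factors of the product group.\<close>
  then obtain e where e: "bij_betw e (A - {i}) {..<card A - 1}"
    using finite_same_card_bij[of "A - {i}" "{..<card A - 1}"] assms by auto
  define g where "g = inv_into (A - {i}) e"
  have eg: "e (g t) = t" "g t \<in> A - {i}" if "t < card A - 1" for t
    unfolding g_def using bij_betw_inv_into_right[OF e] bij_betw_inv_into[OF e] that
    by (auto simp: bij_betw_def)
  have ge: "g (e j) = j" "e j < card A - 1" if "j \<in> A" "j \<noteq> i" for j
    unfolding g_def using bij_betw_inv_into_left[OF e] e that by (auto simp: bij_betw_def)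
  have pr: "(\<Prod>j\<in>A. x j ^ k j) = x i ^ k i" for x :: "'i \<Rightarrow> 'k"
    using assms by (subst prod.remove[of _ i]) auto
  have wm: "w ^ nat ((a + b) mod int (k i)) = w ^ nat a * w ^ nat b" if "0 \<le> a" "0 \<le> b" for a b
  proof -
    have "nat ((a + b) mod int (k i)) = (nat a + nat b) mod k i"
      using that by (simp add: nat_mod_distrib nat_add_distrib)
    moreover have "w ^ (c mod k i) = w ^ c" for c
    proof -
      have "w ^ c = (w ^ k i) ^ (c div k i) * w ^ (c mod k i)"
        by (simp flip: power_mult power_add)
      then show ?thesis using w by simp
    qed
    ultimately show ?thesis by (simp add: power_add)
  qed
  \<comment> \<open>The map starts from the product, where exponentiation is explicit; the logarithm
    is needed only for its inverse.\<close>
  let ?F = "\<lambda>(u, a). \<lambda>j\<in>A. if j = i then w ^ nat a else u (e j)"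
  have F: "?F \<in> hom ?G (torus_kernel A k)"
  proof (rule homI)
    fix x assume x: "x \<in> carrier ?G"
    obtain u a where [simp]: "x = (u, a)" by (cases x)
    have "(w ^ nat a) ^ k i = (w ^ k i) ^ nat a" by (simp flip: power_mult add: mult.commute)
    then show "?F x \<in> carrier (torus_kernel A k)"
      using x assms w0 w ge(2) by (auto simp: pr mult_group_def PiE_iff split: if_splits)
  next
    fix x y assume "x \<in> carrier ?G" "y \<in> carrier ?G"
    then show "?F (x \<otimes>\<^bsub>?G\<^esub> y) = ?F x \<otimes>\<^bsub>torus_kernel A k\<^esub> ?F y"
      using assms ge(2) by (auto simp: fun_eq_iff carrier_integer_mod_group mult_group_def wm)
  qed
  have "bij_betw ?F (carrier ?G) (carrier (torus_kernel A k))"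
  proof (rule bij_betw_byWitness[where f' = "\<lambda>x. (\<lambda>t\<in>{..<card A - 1}. x (g t), lg (x i))"])
    show "?F ` carrier ?G \<subseteq> carrier (torus_kernel A k)"
      by (rule hom_carrier[OF F])
    show "\<forall>x\<in>carrier ?G. (\<lambda>t\<in>{..<card A - 1}. ?F x (g t), lg (?F x i)) = x"
      using assms eg lg1
      by (auto simp: fun_eq_iff carrier_integer_mod_group PiE_iff extensional_def)
    show "\<forall>x\<in>carrier (torus_kernel A k). ?F (\<lambda>t\<in>{..<card A - 1}. x (g t), lg (x i)) = x"
      using assms ge lg2 by (auto simp: fun_eq_iff pr PiE_iff extensional_def)
    show "(\<lambda>x. (\<lambda>t\<in>{..<card A - 1}. x (g t), lg (x i))) ` carrier (torus_kernel A k) \<subseteq> carrier ?G"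
      using assms eg(2) lg3
      by (auto simp: pr carrier_integer_mod_group mult_group_def PiE_iff split: if_splits)
  qed
  with F have "?G \<cong> (torus_kernel A k :: ('i \<Rightarrow> 'k) monoid)" by (intro is_isoI isoI)
  then show ?thesis by (rule group.iso_sym[rotated]) (intro DirProd_group; simp)
qed

text \<open>The Euclidean algorithm, by induction on the sum of the exponents: while two are
  positive, a shear subtracts the smaller from the larger. This keeps the gcd and lowers the
  sum.\<close>

lemma torus_kernel_iso:
  fixes k :: "'i \<Rightarrow> nat"
  assumes "finite A" "\<exists>j\<in>A. k j > 0"
  shows "(torus_kernel A k :: ('i \<Rightarrow> 'k::{alg_closed_field, field_char_0}) monoid) \<cong>
    product_group {..<card A - 1} (\<lambda>_. mult_group :: 'k monoid) \<times>\<times> integer_mod_group (Gcd (k ` A))"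
  using assms(2)
proof (induction "\<Sum>j\<in>A. k j" arbitrary: k rule: less_induct)
  case less
  show ?case
  proof (cases "\<exists>i\<in>A. \<exists>j\<in>A. i \<noteq> j \<and> k i > 0 \<and> k j > 0")
    case True
    then obtain i j where ij: "i \<in> A" "j \<in> A" "i \<noteq> j" "0 < k j" "k j \<le> k i"
      by (metis linorder_le_cases)
    let ?k' = "k(i := k i - k j)"
    have "(\<Sum>l\<in>A. ?k' l) < (\<Sum>l\<in>A. k l)"
      by (rule sum_strict_mono_ex1) (use ij assms in auto)
    \<comment> \<open>The exponent at \<open>j\<close> is untouched, so it stays positive even if
      the one at \<open>i\<close> drops to 0.\<close>
    moreover have "\<exists>l\<in>A. ?k' l > 0" using ij by auto
    ultimately have "(torus_kernel A ?k' :: ('i \<Rightarrow> 'k) monoid) \<cong>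
        product_group {..<card A - 1} (\<lambda>_. mult_group :: 'k monoid) \<times>\<times> integer_mod_group (Gcd (?k' ` A))"
      by (rule less.hyps)
    moreover have "Gcd (?k' ` A) = Gcd (k ` A)"
    proof -
      \<comment> \<open>Equality of gcds is obtained by comparing common divisors.\<close>
      have "(\<forall>l\<in>A. d dvd ?k' l) \<longleftrightarrow> (\<forall>l\<in>A. d dvd k l)" for d
      proof -
        have "d dvd k j \<Longrightarrow> d dvd k i - k j \<longleftrightarrow> d dvd k i"
          using ij(5) by (metis dvd_add_left_iff le_add_diff_inverse2)
        moreover have "(\<forall>l\<in>A. d dvd f l) \<longleftrightarrow>
            d dvd f i \<and> d dvd f j \<and> (\<forall>l\<in>A - {i, j}. d dvd f l)" for f
          using ij(1,2) by blast
        moreover have "(\<forall>l\<in>A - {i, j}. d dvd ?k' l) \<longleftrightarrow> (\<forall>l\<in>A - {i, j}. d dvd k l)"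
          by simp
        ultimately show ?thesis using ij(3) by (metis fun_upd_same fun_upd_other)
      qed
      then have "d dvd Gcd (?k' ` A) \<longleftrightarrow> d dvd Gcd (k ` A)" for d
        by (simp add: dvd_Gcd_iff del: fun_upd_apply)
      then show ?thesis by (metis dvd_antisym dvd_refl)
    qed
    ultimately show ?thesis
      using torus_kernel_shear[OF assms(1) ij(1-3,5)] iso_trans by metis
  next
    case False
    with less.prems obtain i where i: "i \<in> A" "k i > 0" "\<And>j. j \<in> A \<Longrightarrow> j \<noteq> i \<Longrightarrow> k j = 0"
      by (metis gr0I)
    \<comment> \<open>All other exponents are 0, and every number divides 0.\<close>
    have "Gcd (k ` A) = k i"
    proof (rule dvd_antisym)
      show "k i dvd Gcd (k ` A)" using i by (intro Gcd_greatest) (metis dvd_0_right dvd_refl imageE)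
    qed (use i in \<open>auto intro: Gcd_dvd\<close>)
    then show ?thesis using torus_kernel_single[OF assms(1), of i k] i by simp
  qed
qed


section \<open>Evaluation of polynomials\<close>

lemma dconst_0 [simp]: "dconst 0 = 0"
  and dconst_1 [simp]: "dconst 1 = 1"
  and dconst_add: "dconst (a + b) = dconst a + dconst b"
  and dconst_mult: "dconst (a * b) = dconst a * dconst b"
  by (simp_all add: dconst_def single_add mult_single)

lemma dconst_power: "dconst (a ^ n) = dconst a ^ n"
  by (induction n) (simp_all add: dconst_mult)

lemma dconst_prod: "dconst (\<Prod>j\<in>A. f j) = (\<Prod>j\<in>A. dconst (f j))"
  by (induction A rule: infinite_finite_induct) (simp_all add: dconst_mult)

text \<open>Converts the induction rule for finitely supported maps, which proceeds by updates at
  fresh points, into induction by adding terms.\<close>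

lemma update_eq_add:
  assumes "a \<notin> Poly_Mapping.keys f"
  shows "Poly_Mapping.update a b f = Poly_Mapping.single a b + f"
  using assms
  by (intro poly_mapping_eqI) (auto simp: lookup_update lookup_add lookup_single when_def in_keys_iff)

lemma carrier_dpoly_ring:
  "p \<in> carrier (dpoly_ring V) \<longleftrightarrow> (\<forall>a\<in>Poly_Mapping.keys p. Poly_Mapping.keys a \<subseteq> V)"
  by (simp add: dpoly_ring_def)

lemma dpoly_ring_simps [simp]:
  "p \<otimes>\<^bsub>dpoly_ring V\<^esub> q = p * q" "p \<oplus>\<^bsub>dpoly_ring V\<^esub> q = p + q"
  "\<one>\<^bsub>dpoly_ring V\<^esub> = 1" "\<zero>\<^bsub>dpoly_ring V\<^esub> = 0"
  by (simp_all add: dpoly_ring_def)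

lemma dpoly_ring_closed:
  "0 \<in> carrier (dpoly_ring V)" "1 \<in> carrier (dpoly_ring V)"
  "dconst c \<in> carrier (dpoly_ring V)"
  "v \<in> V \<Longrightarrow> dvariable v \<in> carrier (dpoly_ring V)"
  "p \<in> carrier (dpoly_ring V) \<Longrightarrow> q \<in> carrier (dpoly_ring V) \<Longrightarrow> p + q \<in> carrier (dpoly_ring V)"
  "p \<in> carrier (dpoly_ring V) \<Longrightarrow> q \<in> carrier (dpoly_ring V) \<Longrightarrow> p * q \<in> carrier (dpoly_ring V)"
  "p \<in> carrier (dpoly_ring V) \<Longrightarrow> - p \<in> carrier (dpoly_ring V)"
proof -
  assume p: "p \<in> carrier (dpoly_ring V)" and q: "q \<in> carrier (dpoly_ring V)"
  show "p + q \<in> carrier (dpoly_ring V)"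
    using p q keys_add[of p q] by (auto simp: carrier_dpoly_ring)
  show "p * q \<in> carrier (dpoly_ring V)"
    unfolding carrier_dpoly_ring
  proof
    fix a assume "a \<in> Poly_Mapping.keys (p * q)"
    then obtain b c where "a = b + c" "b \<in> Poly_Mapping.keys p" "c \<in> Poly_Mapping.keys q"
      using keys_mult[of p q] by blast
    then show "Poly_Mapping.keys a \<subseteq> V"
      using p q keys_add[of b c] by (fastforce simp: carrier_dpoly_ring)
  qed
qed (auto simp: carrier_dpoly_ring dconst_def dvariable_def in_keys_iff lookup_single lookup_one
    when_def split: if_splits)

lemma dpoly_ring_diff:
  "p \<in> carrier (dpoly_ring V) \<Longrightarrow> q \<in> carrier (dpoly_ring V) \<Longrightarrow> p - q \<in> carrier (dpoly_ring V)"
  by (metis diff_conv_add_uminus dpoly_ring_closed(5,7))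

lemma dpoly_ring_power: "p \<in> carrier (dpoly_ring V) \<Longrightarrow> p ^ n \<in> carrier (dpoly_ring V)"
  by (induction n) (auto intro: dpoly_ring_closed)

lemma dpoly_ring_prod:
  "(\<And>j. j \<in> A \<Longrightarrow> f j \<in> carrier (dpoly_ring V)) \<Longrightarrow> (\<Prod>j\<in>A. f j) \<in> carrier (dpoly_ring V)"
  by (induction A rule: infinite_finite_induct) (auto intro: dpoly_ring_closed)

lemma cring_dpoly_ring: "cring (dpoly_ring V)"
proof (rule cringI)
  show "abelian_group (dpoly_ring V)"
  proof (rule abelian_groupI)
    fix x assume "x \<in> carrier (dpoly_ring V)"
    then show "\<exists>y\<in>carrier (dpoly_ring V). y \<oplus>\<^bsub>dpoly_ring V\<^esub> x = \<zero>\<^bsub>dpoly_ring V\<^esub>"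
      by (intro bexI[of _ "- x"]) (auto intro: dpoly_ring_closed)
  qed (auto intro: dpoly_ring_closed simp: add_ac)
  show "Group.comm_monoid (dpoly_ring V)"
    by (rule comm_monoidI) (auto intro: dpoly_ring_closed simp: mult_ac)
qed (simp add: distrib_right)

text \<open>Constants and variables generate the ring: powers of variables give monomials, and
  monomials give all polynomials term by term.\<close>

lemma dpoly_ring_induct [consumes 1, case_names const variable add mult]:
  fixes p :: "'k::comm_ring_1 dpoly"
  assumes "p \<in> carrier (dpoly_ring V)"
    and const: "\<And>c. Q (dconst c)" and var: "\<And>v. v \<in> V \<Longrightarrow> Q (dvariable v)"
    and add: "\<And>p q. p \<in> carrier (dpoly_ring V) \<Longrightarrow> q \<in> carrier (dpoly_ring V) \<Longrightarrow>
      Q p \<Longrightarrow> Q q \<Longrightarrow> Q (p + q)"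
    and mult: "\<And>p q. p \<in> carrier (dpoly_ring V) \<Longrightarrow> q \<in> carrier (dpoly_ring V) \<Longrightarrow>
      Q p \<Longrightarrow> Q q \<Longrightarrow> Q (p * q)"
  shows "Q p"
proof -
  \<comment> \<open>Membership is carried along because the closure assumptions on \<open>Q\<close>
    apply only inside the carrier.\<close>
  let ?Q = "\<lambda>p. p \<in> carrier (dpoly_ring V) \<and> Q p"
  have pow: "?Q (dvariable v ^ n)" if "v \<in> V" for v n
    using that const[of 1]
    by (induction n) (auto intro!: mult var intro: dpoly_ring_closed dpoly_ring_power)
  have monomial: "Poly_Mapping.keys a \<subseteq> V \<Longrightarrow> ?Q (Poly_Mapping.single a c)" for a c
  proof (induction a rule: update_induct)
    case const
    then show ?case using assms(2)[of c] dpoly_ring_closed(3)[of c V] by (simp add: dconst_def)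
  next
    case (update a v n)
    then have v: "v \<in> V" "?Q (Poly_Mapping.single a c)" by (auto simp: keys_update)
    have "dvariable v ^ n = Poly_Mapping.single (Poly_Mapping.single v n) (1::'k)"
    proof (induction n)
      case (Suc n)
      then show ?case by (simp add: dvariable_def mult_single single_add[symmetric])
    qed (simp flip: single_one)
    then have "Poly_Mapping.single (Poly_Mapping.update v n a) c = dvariable v ^ n * Poly_Mapping.single a c"
      using update.hyps by (simp add: update_eq_add mult_single)
    with v pow[OF v(1), of n] show ?case by (auto intro: mult dpoly_ring_closed)
  qed
  have "p \<in> carrier (dpoly_ring V) \<Longrightarrow> ?Q p"
  proof (induction p rule: update_induct)
    case const
    then show ?case using assms(2)[of 0] by simp
  next
    case (update p a c)
    then have "?Q p" "?Q (Poly_Mapping.single a c)"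
      by (auto simp: carrier_dpoly_ring keys_update intro!: monomial[THEN conjunct2])
    then show ?case using update.hyps
      by (auto simp: update_eq_add intro: add dpoly_ring_closed)
  qed
  with assms(1) show ?thesis by blast
qed

section \<open>Substitution homomorphisms\<close>

text \<open>The map given by the universal property of the polynomial ring. Taking \<open>id\<close>
  for \<open>\<phi>\<close> evaluates at a point; taking \<open>dconst\<close> substitutes
  polynomials for the variables.\<close>

definition dpoly_eval :: "('k::comm_ring_1 \<Rightarrow> 'b::comm_ring_1) \<Rightarrow> (dvar \<Rightarrow> 'b) \<Rightarrow> 'k dpoly \<Rightarrow> 'b" where
  "dpoly_eval \<phi> v p = (\<Sum>a\<in>Poly_Mapping.keys p.
     \<phi> (Poly_Mapping.lookup p a) * (\<Prod>x\<in>Poly_Mapping.keys a. v x ^ Poly_Mapping.lookup a x))"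

locale coeff_hom =
  fixes \<phi> :: "'k::comm_ring_1 \<Rightarrow> 'b::comm_ring_1"
  assumes hom_1 [simp]: "\<phi> 1 = 1"
    and hom_add: "\<phi> (a + b) = \<phi> a + \<phi> b"
    and hom_mult: "\<phi> (a * b) = \<phi> a * \<phi> b"
begin

lemma hom_0 [simp]: "\<phi> 0 = 0"
  using hom_add[of 0 0] by simp

lemma eval_0 [simp]: "dpoly_eval \<phi> v 0 = 0"
  by (simp add: dpoly_eval_def)

lemma eval_single:
  "dpoly_eval \<phi> v (Poly_Mapping.single a c) =
     \<phi> c * (\<Prod>x\<in>Poly_Mapping.keys a. v x ^ Poly_Mapping.lookup a x)"
  by (cases "c = 0") (simp_all add: dpoly_eval_def)

lemma eval_const [simp]: "dpoly_eval \<phi> v (dconst c) = \<phi> c"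
  by (simp add: dconst_def eval_single)

lemma eval_variable [simp]: "dpoly_eval \<phi> v (dvariable x) = v x"
  by (simp add: dvariable_def eval_single)

lemma eval_1 [simp]: "dpoly_eval \<phi> v 1 = 1"
  using eval_const[of v 1] by simp

lemma eval_add [simp]: "dpoly_eval \<phi> v (p + q) = dpoly_eval \<phi> v p + dpoly_eval \<phi> v q"
  unfolding dpoly_eval_def
  by (rule setsum_keys_plus_distrib) (simp_all add: hom_add distrib_right)

lemma eval_monomial_add:
  fixes a b :: "dvar \<Rightarrow>\<^sub>0 nat"
  shows "(\<Prod>x\<in>Poly_Mapping.keys (a + b). v x ^ Poly_Mapping.lookup (a + b) x) =
    (\<Prod>x\<in>Poly_Mapping.keys a. v x ^ Poly_Mapping.lookup a x) *
    (\<Prod>x\<in>Poly_Mapping.keys b. (v x :: 'b) ^ Poly_Mapping.lookup b x)"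
proof -
  let ?K = "Poly_Mapping.keys a \<union> Poly_Mapping.keys b"
  \<comment> \<open>Exponents are 0 outside the support, so all three products can be taken over the
    union of the supports; cancellation cannot occur to matter, since extra factors are 1.\<close>
  have *: "(\<Prod>x\<in>Poly_Mapping.keys c. v x ^ Poly_Mapping.lookup c x) =
      (\<Prod>x\<in>?K. v x ^ Poly_Mapping.lookup c x)" if "Poly_Mapping.keys c \<subseteq> ?K" for c
    using that by (intro prod.mono_neutral_left) (auto simp: in_keys_iff)
  show ?thesis
    unfolding *[OF keys_add] *[OF Un_upper1] *[OF Un_upper2]
    by (simp add: lookup_add power_add prod.distrib)
qed

text \<open>Both sides are biadditive, so two nested inductions reduce the claim to a product of two
  single terms.\<close>

lemma eval_mult [simp]: "dpoly_eval \<phi> v (p * q) = dpoly_eval \<phi> v p * dpoly_eval \<phi> v q"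
proof (induction p rule: update_induct)
  case (update p a c)
  have "dpoly_eval \<phi> v (Poly_Mapping.single a c * q) =
      dpoly_eval \<phi> v (Poly_Mapping.single a c) * dpoly_eval \<phi> v q"
  proof (induction q rule: update_induct)
    case (update q b d)
    then show ?case
      by (simp add: update_eq_add distrib_left mult_single eval_single eval_monomial_add
          hom_mult mult_ac)
  qed simp
  with update show ?case by (simp add: update_eq_add distrib_right)
qed simp

lemma eval_power: "dpoly_eval \<phi> v (p ^ n) = dpoly_eval \<phi> v p ^ n"
  by (induction n) simp_all

lemma eval_prod: "dpoly_eval \<phi> v (\<Prod>j\<in>A. f j) = (\<Prod>j\<in>A. dpoly_eval \<phi> v (f j))"
  by (induction A rule: infinite_finite_induct) simp_all

lemma eval_uminus: "dpoly_eval \<phi> v (- p) = - dpoly_eval \<phi> v p"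
  using eval_add[of v p "- p"] by (simp add: eq_neg_iff_add_eq_0 add.commute)

lemma eval_diff [simp]: "dpoly_eval \<phi> v (p - q) = dpoly_eval \<phi> v p - dpoly_eval \<phi> v q"
  using eval_add[of v p "- q"] by (simp add: eval_uminus)

lemma eval_eval_Z: "dpoly_eval \<phi> v (eval_Z P) = poly (map_poly \<phi> P) (v VarZ)"
  by (induction P) (simp_all add: eval_Z_def map_poly_pCons)

end

lemma eval_Z_pCons: "eval_Z (pCons a P) = dconst a + dvariable VarZ * eval_Z P"
  by (simp add: eval_Z_def map_poly_pCons)

lemma eval_Z_closed: "VarZ \<in> V \<Longrightarrow> eval_Z P \<in> carrier (dpoly_ring V)"
proof (induction P)
  case 0
  then show ?case by (simp add: eval_Z_def dpoly_ring_closed)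
next
  case (pCons a P)
  then show ?case unfolding eval_Z_pCons by (intro dpoly_ring_closed)
qed

interpretation const_hom: coeff_hom dconst
  by unfold_locales (simp_all add: dconst_add dconst_mult)

interpretation id_hom: coeff_hom "id :: 'k::comm_ring_1 \<Rightarrow> 'k"
  by unfold_locales simp_all


section \<open>The scaling automorphisms of the Danielewski ring\<close>

text \<open>The bound on \<open>m\<close> places \<open>Y_1\<close> among the variables, so that the
  defining equation lies in the polynomial ring.\<close>

locale danielewski =
  fixes m :: nat and k :: "nat \<Rightarrow> nat" and P :: "'k::field poly"
  assumes m_ge_1: "m \<ge> 1"
begin

abbreviation R :: "'k dpoly ring" where "R \<equiv> danielewski_poly_ring m"
abbreviation I :: "'k dpoly set" where "I \<equiv> danielewski_ideal m k P"
abbreviation A :: "'k dpoly set ring" where "A \<equiv> danielewski_ring m k P"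
abbreviation cls :: "'k dpoly \<Rightarrow> 'k dpoly set" where "cls \<equiv> danielewski_class m k P"
abbreviation con :: "'k \<Rightarrow> 'k dpoly set" where "con \<equiv> danielewski_const m k P"
abbreviation equation :: "'k dpoly" where
  "equation \<equiv> dvariable (VarY 1) * danielewski_monom m k - eval_Z P"

definition vars :: "dvar set" where "vars = insert VarZ (VarY ` {1..m})"

lemma R_eq: "R = dpoly_ring vars"
  unfolding danielewski_poly_ring_def vars_def ..

lemma vars_iff: "v \<in> vars \<longleftrightarrow> v = VarZ \<or> (\<exists>j\<in>{1..m}. v = VarY j)"
  by (auto simp: vars_def)

lemma R_simps [simp]:
  "p \<otimes>\<^bsub>R\<^esub> q = p * q" "p \<oplus>\<^bsub>R\<^esub> q = p + q" "\<one>\<^bsub>R\<^esub> = 1" "\<zero>\<^bsub>R\<^esub> = 0"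
  unfolding R_eq by (rule dpoly_ring_simps)+

lemma R_closed [simp]:
  "dconst c \<in> carrier R" "eval_Z Q \<in> carrier R" "danielewski_monom m k \<in> carrier R"
  "dvariable VarZ \<in> carrier R" "j \<in> {1..m} \<Longrightarrow> dvariable (VarY j) \<in> carrier R"
  "p \<in> carrier R \<Longrightarrow> q \<in> carrier R \<Longrightarrow> p + q \<in> carrier R"
  "p \<in> carrier R \<Longrightarrow> q \<in> carrier R \<Longrightarrow> p * q \<in> carrier R"
  "p \<in> carrier R \<Longrightarrow> q \<in> carrier R \<Longrightarrow> p - q \<in> carrier R"
  "1 \<in> carrier R"
proof -
  show y: "dvariable (VarY j) \<in> carrier R" if "j \<in> {1..m}" for j
    using that unfolding R_eq by (intro dpoly_ring_closed) (simp add: vars_iff)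
  show "danielewski_monom m k \<in> carrier R"
    unfolding danielewski_monom_def using y unfolding R_eq
    by (intro dpoly_ring_prod dpoly_ring_power) auto
  show "eval_Z Q \<in> carrier R" "dvariable VarZ \<in> carrier R"
    unfolding R_eq by (intro eval_Z_closed dpoly_ring_closed; simp add: vars_iff)+
qed (unfold R_eq, (rule dpoly_ring_closed dpoly_ring_diff; assumption)+)

sublocale R: cring R
  unfolding R_eq by (rule cring_dpoly_ring)

lemma equation_closed [simp]: "equation \<in> carrier R"
  using m_ge_1 by (intro R_closed) auto

lemma mem_I_iff: "p \<in> I \<longleftrightarrow> (\<exists>q\<in>carrier R. p = q * equation)"
  by (auto simp: danielewski_ideal_def cgenideal_def)

sublocale I: ideal I R
  unfolding danielewski_ideal_def by (rule R.cgenideal_ideal[OF equation_closed])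

sublocale A: cring A
  unfolding danielewski_ring_def by (rule I.quotient_is_cring[OF R.is_cring])

lemma cls_eq: "cls p = (\<lambda>i. i + p) ` I"
  by (auto simp: danielewski_class_def a_r_coset_def')

lemma carrier_A: "carrier A = cls ` carrier R"
  by (auto simp: danielewski_ring_def FactRing_def A_RCOSETS_def' danielewski_class_def)

lemma cls_closed [simp]: "p \<in> carrier R \<Longrightarrow> cls p \<in> carrier A"
  by (simp add: carrier_A)

lemma con_closed [simp]: "con c \<in> carrier A"
  unfolding danielewski_const_def by (intro cls_closed R_closed)

lemma cls_ring_hom: "cls \<in> ring_hom R A"
  unfolding danielewski_ring_def danielewski_class_def[abs_def] by (rule I.rcos_ring_hom)

lemma cls_add: "p \<in> carrier R \<Longrightarrow> q \<in> carrier R \<Longrightarrow> cls (p + q) = cls p \<oplus>\<^bsub>A\<^esub> cls q"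
  using ring_hom_add[OF cls_ring_hom] by simp

lemma cls_mult: "p \<in> carrier R \<Longrightarrow> q \<in> carrier R \<Longrightarrow> cls (p * q) = cls p \<otimes>\<^bsub>A\<^esub> cls q"
  using ring_hom_mult[OF cls_ring_hom] by simp

lemma cls_1: "cls 1 = \<one>\<^bsub>A\<^esub>"
  using ring_hom_one[OF cls_ring_hom] by simp

text \<open>The generation of the polynomial ring passes to the quotient. This allows homomorphisms,
  and their commutation with a derivation, to be checked on generators.\<close>

lemma danielewski_ring_induct [consumes 1, case_names const y z add mult]:
  assumes "f \<in> carrier A"
    and "\<And>c. Q (con c)" "\<And>j. j \<in> {1..m} \<Longrightarrow> Q (danielewski_y m k P j)"
    and "Q (danielewski_z m k P)"
    and add: "\<And>f g. f \<in> carrier A \<Longrightarrow> g \<in> carrier A \<Longrightarrow> Q f \<Longrightarrow> Q g \<Longrightarrow> Q (f \<oplus>\<^bsub>A\<^esub> g)"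
    and mult: "\<And>f g. f \<in> carrier A \<Longrightarrow> g \<in> carrier A \<Longrightarrow> Q f \<Longrightarrow> Q g \<Longrightarrow> Q (f \<otimes>\<^bsub>A\<^esub> g)"
  shows "Q f"
proof -
  obtain p where p: "p \<in> carrier R" "f = cls p"
    using assms(1) by (auto simp: carrier_A)
  from p(1)[unfolded R_eq] have "Q (cls p)"
  proof (induction p rule: dpoly_ring_induct)
    case (const c)
    then show ?case using assms(2)[of c] by (simp add: danielewski_const_def)
  next
    case (variable v)
    then show ?case using assms(3,4) by (auto simp: vars_iff danielewski_y_def danielewski_z_def)
  next
    case (add p q)
    then show ?case
      using cls_add[of p q] assms(5)[of "cls p" "cls q"] by (auto simp: R_eq[symmetric])
  next
    case (mult p q)
    then show ?case
      using cls_mult[of p q] assms(6)[of "cls p" "cls q"] by (auto simp: R_eq[symmetric])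
  qed
  with p show ?thesis by simp
qed

text \<open>Evaluation at the point \<open>y\<^sub>2 = \<dots> = y\<^sub>m = 1\<close>, \<open>z = 0\<close> of the variety, at which the classes
  of the relevant monomials do not vanish.\<close>

definition ev :: "'k dpoly \<Rightarrow> 'k" where
  "ev = dpoly_eval id
     (\<lambda>v. case v of VarY j \<Rightarrow> if j = 1 then poly P 0 else 1 | VarZ \<Rightarrow> 0)"

lemma ev_const_mult: "ev (dconst c * p) = c * ev p"
  by (simp add: ev_def)

lemma ev_monom: "ev (danielewski_monom m k) = 1"
  by (simp add: ev_def danielewski_monom_def id_hom.eval_prod id_hom.eval_power)

text \<open>With \<open>z = 0\<close> and \<open>y_j = 1\<close> for \<open>j \<ge> 2\<close>, the
  equation forces \<open>y_1 = P(0)\<close>, which is the value chosen in \<open>ev\<close>.\<close>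

lemma ev_equation: "ev equation = 0"
  using ev_monom by (simp add: ev_def id_hom.eval_eval_Z map_poly_id)

text \<open>As \<open>ev\<close> kills the equation, it kills the ideal and descends to the
  quotient. It serves to tell classes apart.\<close>

lemma cls_eq_imp_ev_eq:
  assumes "cls p = cls q"
  shows "ev p = ev q"
proof -
  have "0 \<in> I" using mem_I_iff[of 0] I.zero_closed by simp
  then have "p \<in> cls p" by (force simp: cls_eq)
  then obtain i where "i \<in> I" "p = i + q" using assms by (auto simp: cls_eq)
  then show ?thesis
    using ev_equation by (auto simp: mem_I_iff ev_def)
qed

section \<open>Scalings of the variables and the proper torus\<close>

text \<open>Torus parameters, extended to all variables of the type. Being nonzero everywhere, they
  can be inverted pointwise.\<close>

definition admissible :: "(dvar \<Rightarrow> 'k) \<Rightarrow> bool" where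
  "admissible l \<longleftrightarrow> l VarZ = 1 \<and> (\<forall>j. l (VarY j) \<noteq> 0) \<and>
     l (VarY 1) * (\<Prod>j\<in>{2..m}. l (VarY j) ^ k j) = 1"

definition scale :: "(dvar \<Rightarrow> 'k) \<Rightarrow> 'k dpoly \<Rightarrow> 'k dpoly" where
  "scale l = dpoly_eval dconst (\<lambda>v. dconst (l v) * dvariable v)"

lemma scale_simps [simp]:
  "scale l (p + q) = scale l p + scale l q" "scale l (p - q) = scale l p - scale l q"
  "scale l (p * q) = scale l p * scale l q" "scale l 1 = 1" "scale l (dconst c) = dconst c"
  "scale l (dvariable v) = dconst (l v) * dvariable v"
  by (simp_all add: scale_def)

lemma scale_monom:
  "scale l (danielewski_monom m k) =
     dconst (\<Prod>j\<in>{2..m}. l (VarY j) ^ k j) * danielewski_monom m k"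
  by (simp add: scale_def danielewski_monom_def const_hom.eval_prod const_hom.eval_power
      power_mult_distrib prod.distrib dconst_prod dconst_power)

lemma scale_eval_Z: "l VarZ = 1 \<Longrightarrow> scale l (eval_Z Q) = eval_Z Q"
  by (simp add: scale_def const_hom.eval_eval_Z) (simp add: eval_Z_def)

text \<open>The monomial term is multiplied by the product that the torus relation sets to 1, and
  \<open>P(Z)\<close> does not change because \<open>Z\<close> is fixed.\<close>

lemma scale_equation:
  assumes "admissible l"
  shows "scale l equation = equation"
proof -
  let ?p = "\<Prod>j\<in>{2..m}. l (VarY j) ^ k j"
  have "scale l equation =
      dconst (l (VarY 1)) * dconst ?p * (dvariable (VarY 1) * danielewski_monom m k) - eval_Z P"
    using assms by (simp add: scale_monom scale_eval_Z admissible_def)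
  also have "dconst (l (VarY 1)) * dconst ?p = 1"
    using assms by (simp add: admissible_def flip: dconst_mult)
  finally show ?thesis by simp
qed

lemma scale_closed [simp]:
  assumes "p \<in> carrier R"
  shows "scale l p \<in> carrier R"
  using assms[unfolded R_eq]
  unfolding R_eq
  by (induction p rule: dpoly_ring_induct) (auto intro: dpoly_ring_closed)

lemma scale_scale:
  assumes "p \<in> carrier R"
  shows "scale l (scale l' p) = scale (\<lambda>v. l v * l' v) p"
  using assms[unfolded R_eq]
  by (induction p rule: dpoly_ring_induct) (auto simp: dconst_mult mult_ac)

lemma scale_one:
  assumes "p \<in> carrier R"
  shows "scale (\<lambda>v. 1) p = p"
  using assms[unfolded R_eq]
  by (induction p rule: dpoly_ring_induct) auto

lemma admissible_inverse: "admissible l \<Longrightarrow> admissible (\<lambda>v. inverse (l v))"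
  unfolding admissible_def
  by (simp add: power_inverse prod_inversef[unfolded comp_def] flip: inverse_mult_distrib)

lemma admissible_nonzero: "admissible l \<Longrightarrow> l v \<noteq> 0"
  by (cases v) (auto simp: admissible_def)

lemma scale_inverse:
  assumes "admissible l" "p \<in> carrier R"
  shows "scale l (scale (\<lambda>v. inverse (l v)) p) = p"
    and "scale (\<lambda>v. inverse (l v)) (scale l p) = p"
  using assms by (simp_all add: scale_scale admissible_nonzero scale_one)

lemma scale_I: "admissible l \<Longrightarrow> i \<in> I \<Longrightarrow> scale l i \<in> I"
  unfolding mem_I_iff by (metis scale_closed scale_equation scale_simps(3))

text \<open>The scaling and its inverse both preserve the ideal, so the scaling maps it onto itself
  and hence cosets onto cosets.\<close>

lemma scale_image_cls:
  assumes l: "admissible l"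
  shows "scale l ` cls p = cls (scale l p)"
proof -
  have "scale l ` I = I"
  proof
    show "I \<subseteq> scale l ` I"
    proof
      fix i assume i: "i \<in> I"
      then have "scale (\<lambda>v. inverse (l v)) i \<in> I" "i \<in> carrier R"
        using admissible_inverse[OF l] scale_I I.Icarr by auto
      with scale_inverse(1)[OF l] show "i \<in> scale l ` I" by (metis imageI)
    qed
  qed (use scale_I[OF l] in auto)
  then have "cls (scale l p) = (\<lambda>i. i + scale l p) ` scale l ` I" by (simp add: cls_eq)
  then show ?thesis by (simp add: cls_eq image_image)
qed

text \<open>Taking the image of a coset gives the induced map without choosing
  representatives.\<close>

definition scale_aut :: "(dvar \<Rightarrow> 'k) \<Rightarrow> 'k dpoly set \<Rightarrow> 'k dpoly set" where
  "scale_aut l = (\<lambda>X\<in>carrier A. scale l ` X)"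

lemma scale_aut_cls:
  "admissible l \<Longrightarrow> p \<in> carrier R \<Longrightarrow> scale_aut l (cls p) = cls (scale l p)"
  by (simp add: scale_aut_def scale_image_cls cls_closed)

lemma scale_aut_alg_auts:
  assumes l: "admissible l"
  shows "scale_aut l \<in> alg_auts A con"
proof -
  have "scale_aut l \<in> ring_hom A A"
    by (rule ring_hom_memI)
      (auto simp: carrier_A scale_aut_cls[OF l] cls_1[symmetric] scale_closed
        simp flip: cls_add cls_mult intro!: imageI)
  moreover have "bij_betw (scale_aut l) (carrier A) (carrier A)"
    by (rule bij_betw_byWitness[where f' = "scale_aut (\<lambda>v. inverse (l v))"])
      (auto simp: carrier_A scale_aut_cls[OF l] scale_aut_cls[OF admissible_inverse[OF l]]
        scale_closed scale_inverse[OF l])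
  moreover have "scale_aut l (con c) = con c" for c
    by (simp add: danielewski_const_def scale_aut_cls[OF l])
  ultimately show ?thesis
    by (auto simp: alg_auts_def Bij_def scale_aut_def)
qed

text \<open>A torus element and the scaling with the same parameters are homomorphisms that agree on
  generators, and both are undefined off the carrier, so they coincide.\<close>

lemma proper_torus_eq: "proper_torus m k P = scale_aut ` {l. admissible l}"
proof (intro equalityI subsetI)
  fix \<theta> assume "\<theta> \<in> proper_torus m k P"
  then obtain l where \<theta>: "\<theta> \<in> alg_auts A con" and l0: "\<forall>j\<in>{1..m}. l j \<noteq> 0"
    and l1: "l 1 * (\<Prod>j\<in>{2..m}. l j ^ k j) = 1"
    and \<theta>_y: "\<And>j. j \<in> {1..m} \<Longrightarrow>
      \<theta> (danielewski_y m k P j) = con (l j) \<otimes>\<^bsub>A\<^esub> danielewski_y m k P j"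
    and \<theta>_z: "\<theta> (danielewski_z m k P) = danielewski_z m k P"
    unfolding proper_torus_def by blast
  \<comment> \<open>The parameters are controlled only at \<open>1..m\<close>; the default 1
    elsewhere makes them admissible.\<close>
  define l' where "l' v = (case v of VarY j \<Rightarrow> if j \<in> {1..m} then l j else 1 | VarZ \<Rightarrow> 1)" for v
  have l'_simps: "l' VarZ = 1" "j \<in> {1..m} \<Longrightarrow> l' (VarY j) = l j" for j
    by (simp_all add: l'_def)
  have "(\<Prod>j\<in>{2..m}. l' (VarY j) ^ k j) = (\<Prod>j\<in>{2..m}. l j ^ k j)"
    by (rule prod.cong) (auto simp: l'_def)
  then have adm: "admissible l'"
    using l0 l1 m_ge_1 by (auto simp: admissible_def l'_def)
  have hom: "\<theta> \<in> ring_hom A A" "\<And>c. \<theta> (con c) = con c" "\<theta> \<in> extensional (carrier A)"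
    using \<theta> by (auto simp: alg_auts_def Bij_def)
  have hom': "scale_aut l' \<in> ring_hom A A" "\<And>c. scale_aut l' (con c) = con c"
    "scale_aut l' \<in> extensional (carrier A)"
    using scale_aut_alg_auts[OF adm] by (auto simp: alg_auts_def Bij_def)
  have "\<theta> f = scale_aut l' f" if "f \<in> carrier A" for f
    using that
  proof (induction f rule: danielewski_ring_induct)
    case (y j)
    then show ?case using \<theta>_y[of j]
      by (simp add: danielewski_y_def danielewski_const_def scale_aut_cls[OF adm] l'_simps cls_mult)
  next
    case z
    then show ?case using \<theta>_z
      by (simp add: danielewski_z_def scale_aut_cls[OF adm] l'_simps)
  qed (use hom hom' in \<open>auto simp: ring_hom_add ring_hom_mult\<close>)
  then have "\<theta> = scale_aut l'"
    using hom(3) hom'(3) by (blast intro: extensionalityI)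
  with adm show "\<theta> \<in> scale_aut ` {l. admissible l}" by blast
next
  fix \<theta> assume "\<theta> \<in> scale_aut ` {l. admissible l}"
  then obtain l where l: "admissible l" "\<theta> = scale_aut l" by blast
  then show "\<theta> \<in> proper_torus m k P"
    unfolding proper_torus_def
    by (auto intro!: scale_aut_alg_auts exI[of _ "\<lambda>j. l (VarY j)"]
        simp: danielewski_y_def danielewski_z_def danielewski_const_def scale_aut_cls
          cls_mult admissible_def)
qed

section \<open>The isotropy group of the derivation\<close>

text \<open>The test element is \<open>z\<close>: it is fixed, so \<open>\<delta>(z)\<close> must be
  fixed too, which forces the product of the \<open>l_j^(k_j)\<close> over \<open>j \<ge> 2\<close>
  to be 1. By the torus relation this means that \<open>y_1\<close> has factor 1. The converse is
  checked on generators.\<close>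

lemma scale_aut_commutes_iff:
  assumes D: "is_canonical_derivation m k P D" and h: "h \<noteq> 0" and l: "admissible l"
  shows "scale_aut l \<in> alg_auts_commuting A con (\<lambda>f. con h \<otimes>\<^bsub>A\<^esub> D f) \<longleftrightarrow> l (VarY 1) = 1"
proof
  let ?\<delta> = "\<lambda>f. con h \<otimes>\<^bsub>A\<^esub> D f"
  let ?M = "danielewski_monom m k"
  have Dz: "?\<delta> (cls (dvariable VarZ)) = cls (dconst h * ?M)"
    using D by (simp add: is_canonical_derivation_def danielewski_z_def danielewski_const_def
        cls_mult)
  {
    assume "scale_aut l \<in> alg_auts_commuting A con ?\<delta>"
    then have "scale_aut l (?\<delta> (cls (dvariable VarZ))) = ?\<delta> (scale_aut l (cls (dvariable VarZ)))"
      by (auto simp: alg_auts_commuting_def)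
    also have "scale_aut l (cls (dvariable VarZ)) = cls (dvariable VarZ)"
      using l by (simp add: scale_aut_cls) (simp add: admissible_def)
    finally have "cls (scale l (dconst h * ?M)) = cls (dconst h * ?M)"
      using l by (simp only: Dz scale_aut_cls R_closed)
    \<comment> \<open>Evaluation gives 1 on the monomial, so only the scalars remain, and
      \<open>h\<close> cancels because it is nonzero.\<close>
    then have "ev (scale l (dconst h * ?M)) = ev (dconst h * ?M)"
      by (rule cls_eq_imp_ev_eq)
    then have "(\<Prod>j\<in>{2..m}. l (VarY j) ^ k j) = 1"
      using h by (simp add: scale_monom ev_const_mult ev_monom)
    then show "l (VarY 1) = 1" using l by (simp add: admissible_def)
  }
  assume l1: "l (VarY 1) = 1"
  have der: "D f \<in> carrier A" "D (f \<oplus>\<^bsub>A\<^esub> g) = D f \<oplus>\<^bsub>A\<^esub> D g"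
    "D (f \<otimes>\<^bsub>A\<^esub> g) = (D f \<otimes>\<^bsub>A\<^esub> g) \<oplus>\<^bsub>A\<^esub> (f \<otimes>\<^bsub>A\<^esub> D g)" "D (con c) = \<zero>\<^bsub>A\<^esub>"
    if "f \<in> carrier A" "g \<in> carrier A" for f g c
    using D that by (auto simp: is_canonical_derivation_def alg_derivation_def)
  have aut: "scale_aut l \<in> ring_hom A A" "\<And>c. scale_aut l (con c) = con c"
    using scale_aut_alg_auts[OF l] by (auto simp: alg_auts_def)
  note hom = ring_hom_add[OF aut(1)] ring_hom_mult[OF aut(1)] ring_hom_closed[OF aut(1)]
    ring_hom_zero[OF aut(1) A.ring_axioms A.ring_axioms]
  \<comment> \<open>Both composites are additive and satisfy the same twisted Leibniz rule, so
    agreement on generators suffices.\<close>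
  have "scale_aut l (D f) = D (scale_aut l f)" if "f \<in> carrier A" for f
    using that
  proof (induction f rule: danielewski_ring_induct)
    case (const c)
    then show ?case using der(4)[of "\<zero>\<^bsub>A\<^esub>" "\<zero>\<^bsub>A\<^esub>"] by (simp add: aut hom)
  next
    case (y j)
    show ?case
    proof (cases "j = 1")
      case True
      have "D (cls (dvariable (VarY 1))) = cls (eval_Z (pderiv P))"
        using D by (simp add: is_canonical_derivation_def danielewski_y_def)
      \<comment> \<open>Here \<open>D(y_1) = P'(z)\<close> involves only the fixed element
        \<open>z\<close>, and \<open>y_1\<close> itself is fixed since its factor is 1.\<close>
      moreover have "scale l (eval_Z (pderiv P)) = eval_Z (pderiv P)"
        using l by (simp add: scale_eval_Z admissible_def)
      ultimately show ?thesis
        using True l1 y by (simp add: danielewski_y_def scale_aut_cls[OF l])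
    next
      case False
      with y have j: "j \<in> {2..m}" by auto
      then have "D (cls (dvariable (VarY j))) = \<zero>\<^bsub>A\<^esub>"
        using D by (simp add: is_canonical_derivation_def danielewski_y_def)
      moreover have "scale_aut l (cls (dvariable (VarY j))) =
          con (l (VarY j)) \<otimes>\<^bsub>A\<^esub> cls (dvariable (VarY j))"
        using y by (simp add: scale_aut_cls[OF l] cls_mult danielewski_const_def)
      moreover have "cls (dvariable (VarY j)) \<in> carrier A"
        using y by (auto intro!: cls_closed)
      ultimately show ?thesis
        by (simp add: danielewski_y_def hom der con_closed)
    qed
  next
    case z
    have "D (cls (dvariable VarZ)) = cls ?M"
      using D by (simp add: is_canonical_derivation_def danielewski_z_def)
    moreover have "scale l ?M = ?M" "l VarZ = 1"
      using l l1 by (simp_all add: scale_monom admissible_def)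
    ultimately show ?case
      by (simp add: danielewski_z_def scale_aut_cls[OF l])
  qed (simp_all add: hom der)
  \<comment> \<open>Commutation passes from \<open>D\<close> to its multiple by \<open>h\<close>
    because the automorphism fixes constants.\<close>
  then show "scale_aut l \<in> alg_auts_commuting A con ?\<delta>"
    using scale_aut_alg_auts[OF l] der(1) by (auto simp: alg_auts_commuting_def hom aut con_closed)
qed

text \<open>Once the first parameter is 1, the torus relation involves only the parameters at
  \<open>2..m\<close> and becomes the equation of the kernel.\<close>

lemma torus_isotropy_iso:
  assumes D: "is_canonical_derivation m k P D" and h: "h \<noteq> 0"
  shows "(torus_kernel {2..m} k :: (nat \<Rightarrow> 'k) monoid) \<cong>
    torus_isotropy m k P (\<lambda>f. con h \<otimes>\<^bsub>A\<^esub> D f)"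
proof -
  let ?K = "torus_kernel {2..m} k :: (nat \<Rightarrow> 'k) monoid"
  let ?T = "torus_isotropy m k P (\<lambda>f. con h \<otimes>\<^bsub>A\<^esub> D f)"
  \<comment> \<open>Extension by 1 to the index 1, to \<open>Z\<close> and to all variables outside
    the ring; it respects pointwise products.\<close>
  define w :: "(nat \<Rightarrow> 'k) \<Rightarrow> dvar \<Rightarrow> 'k" where
    "w x v = (case v of VarY j \<Rightarrow> if j \<in> {2..m} then x j else 1 | VarZ \<Rightarrow> 1)" for x v
  have carrier: "carrier ?T = scale_aut ` {l. admissible l \<and> l (VarY 1) = 1}"
    using scale_aut_commutes_iff[OF D h]
    by (auto simp: torus_isotropy_def proper_torus_eq)
  have pw: "(\<Prod>j\<in>{2..m}. w x (VarY j) ^ k j) = (\<Prod>j\<in>{2..m}. x j ^ k j)" for x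
    by (rule prod.cong) (auto simp: w_def)
  have adm: "admissible (w x)" if "x \<in> carrier ?K" for x
    using that by (auto simp: admissible_def pw PiE_iff) (auto simp: w_def split: if_splits)
  have w1: "w x (VarY 1) = 1" for x by (simp add: w_def)
  let ?F = "\<lambda>x. scale_aut (w x)"
  have "?F \<in> hom ?K ?T"
  proof (rule homI)
    show "?F x \<in> carrier ?T" if "x \<in> carrier ?K" for x
      using adm[OF that] w1 by (auto simp: carrier)
    fix x y assume x: "x \<in> carrier ?K" and y: "y \<in> carrier ?K"
    have xy: "x \<otimes>\<^bsub>?K\<^esub> y \<in> carrier ?K"
      using x y group.is_monoid[OF group_torus_kernel] by (rule monoid.m_closed[rotated])
    have "w (x \<otimes>\<^bsub>?K\<^esub> y) = (\<lambda>v. w x v * w y v)"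
      by (auto simp: w_def fun_eq_iff split: dvar.split)
    moreover from this have "admissible (\<lambda>v. w x v * w y v)" using adm[OF xy] by metis
    ultimately have "?F (x \<otimes>\<^bsub>?K\<^esub> y) f = compose (carrier A) (?F x) (?F y) f"
      if "f \<in> carrier A" for f
      using that by (auto simp: carrier_A compose_def scale_aut_cls adm[OF x] adm[OF y]
          scale_scale simp del: mult_torus_kernel)
    then have "?F (x \<otimes>\<^bsub>?K\<^esub> y) = compose (carrier A) (?F x) (?F y)"
      by (intro extensionalityI[of _ "carrier A"]) (auto simp: scale_aut_def)
    moreover have "?F x \<in> Bij (carrier A)" "?F y \<in> Bij (carrier A)"
      using scale_aut_alg_auts adm x y by (auto simp: alg_auts_def)
    ultimately show "?F (x \<otimes>\<^bsub>?K\<^esub> y) = ?F x \<otimes>\<^bsub>?T\<^esub> ?F y"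
      by (simp add: torus_isotropy_def BijGroup_def del: mult_torus_kernel)
  qed
  moreover have "inj_on ?F (carrier ?K)"
  proof (rule inj_onI)
    fix x y assume x: "x \<in> carrier ?K" and y: "y \<in> carrier ?K" and eq: "?F x = ?F y"
    \<comment> \<open>The chosen point has \<open>y_j = 1\<close>, so evaluating the image of
      \<open>y_j\<close> there recovers the parameter.\<close>
    have "x j = y j" if j: "j \<in> {2..m}" for j
    proof -
      have "dvariable (VarY j) \<in> carrier R" using j by auto
      then have "cls (scale (w x) (dvariable (VarY j))) = cls (scale (w y) (dvariable (VarY j)))"
        using eq by (metis scale_aut_cls adm x y)
      then have "ev (scale (w x) (dvariable (VarY j))) = ev (scale (w y) (dvariable (VarY j)))"
        by (rule cls_eq_imp_ev_eq)
      then show ?thesis using j by (simp add: ev_def w_def)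
    qed
    then show "x = y" using x y by (auto intro: PiE_ext)
  qed
  moreover have "?F ` carrier ?K = carrier ?T"
  proof
    show "carrier ?T \<subseteq> ?F ` carrier ?K"
    proof
      fix \<theta> assume "\<theta> \<in> carrier ?T"
      then obtain l where l: "admissible l" "l (VarY 1) = 1" "\<theta> = scale_aut l"
        by (auto simp: carrier)
      define x where "x = (\<lambda>j\<in>{2..m}. l (VarY j))"
      have x: "x \<in> carrier ?K" using l by (auto simp: x_def admissible_def)
      \<comment> \<open>Outside \<open>vars\<close> the parameters may differ, but a scaling of the
        ring depends only on their values on \<open>vars\<close>.\<close>
      have wl: "w x v = l v" if "v \<in> vars" for v
      proof -
        have "l (VarY j) = 1" if "Suc 0 \<le> j" "\<not> 2 \<le> j" for j
          using that l(2) by (cases "j = 1") auto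
        then show ?thesis using that l by (auto simp: vars_iff x_def w_def admissible_def)
      qed
      have "scale (w x) p = scale l p" if "p \<in> carrier R" for p
        using that[unfolded R_eq]
        by (induction p rule: dpoly_ring_induct) (auto simp: wl)
      then have "\<theta> f = ?F x f" if "f \<in> carrier A" for f
        using that by (auto simp: carrier_A l(3) scale_aut_cls l(1) adm[OF x])
      then have "\<theta> = ?F x"
        by (intro extensionalityI[of _ "carrier A"]) (auto simp: l(3) scale_aut_def)
      with x show "\<theta> \<in> ?F ` carrier ?K" by blast
    qed
  qed (use hom_carrier[OF calculation(1)] in simp)
  ultimately have "?F \<in> iso ?K ?T" by (auto simp: iso_def bij_betw_def)
  then show ?thesis by (rule is_isoI)
qed

end

theorem corollary5p3:
  fixes m d :: nat and k :: "nat \<Rightarrow> nat"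
    and P :: "'k :: {alg_closed_field, field_char_0} poly"
    and D \<delta> :: "'k dpoly set \<Rightarrow> 'k dpoly set" and h :: 'k
  assumes "m \<ge> 2" and "d \<ge> 2" and "\<And>j. j \<in> {2..m} \<Longrightarrow> k j \<ge> 2"
    and "Polynomial.degree P = d" and "lead_coeff P = 1"
    and "is_canonical_derivation m k P D"
    and "h \<noteq> 0"
    and "\<delta> = (\<lambda>f. danielewski_const m k P h \<otimes>\<^bsub>danielewski_ring m k P\<^esub> D f)"
  shows "torus_isotropy m k P \<delta> \<cong>
    product_group {..<m - 2} (\<lambda>_. mult_group :: 'k monoid) \<times>\<times>
      integer_mod_group (Gcd (k ` {2..m}))"
proof -
  interpret danielewski m k P by unfold_locales (use assms(1) in simp)
  let ?K = "torus_kernel {2..m} k :: (nat \<Rightarrow> 'k) monoid"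
  have "torus_isotropy m k P \<delta> \<cong> ?K"
    unfolding assms(8)
    by (rule group.iso_sym[OF group_torus_kernel torus_isotropy_iso[OF assms(6,7)]])
  \<comment> \<open>The bound \<open>m \<ge> 2\<close> makes the index 2 available, and its exponent
    is at least 2.\<close>
  moreover have "\<exists>j\<in>{2..m}. k j > 0"
    using assms(1) assms(3)[of 2] by (intro bexI[of _ 2]) auto
  then have "?K \<cong> product_group {..<card {2..m} - 1} (\<lambda>_. mult_group :: 'k monoid) \<times>\<times>
      integer_mod_group (Gcd (k ` {2..m}))"
    by (intro torus_kernel_iso) auto
  \<comment> \<open>The relation uses up one of the \<open>m - 1\<close> parameters at
    \<open>2..m\<close>.\<close>
  moreover have "card {2..m} - 1 = m - 2" by simp
  ultimately show ?thesis by (metis iso_trans)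
qed

end
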